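(* Let $\mathcal I_{\mathrm{cal}}$ be a finite nonempty index set with $N=|\mathcal I_{\mathrm{cal}}|$, let $Z_t\in\mathbb R^d$ and $Z_i\in\mathbb R^d$ for $i\in\mathcal I_{\mathrm{cal}}$, and let $d_i=\|Z_i-Z_t\|_2$. Let $\phi:[0,\infty)\to[0,\infty)$ be a non-increasing function that is not identically zero on $\{d_i:i\in\mathcal I_{\mathrm{cal}}\}$, and define $$w_{t,i}=\frac{\phi(d_i)}{\sum_{j\in\mathcal I_{\mathrm{cal}}}\phi(d_j)},\qquad i\in\mathcal I_{\mathrm{cal}}.$$ Then $$B_t:=\sum_{i\in\mathcal I_{\mathrm{cal}}}w_{t,i}d_i\ \le\ \frac1N\sum_{i\in\mathcal I_{\mathrm{cal}}}d_i .$$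
   Context: $\|\cdot\|_2$ is the Euclidean norm. $B_t$ is the weighted average distance between the test feature $Z_t$ and the calibration features $Z_i$; the right-hand side is the same quantity for uniform weights $1/N$. *)

theory Defs
  imports "HOL-Analysis.Analysis"
begin

definition feature_dist :: "('i \<Rightarrow> real ^ 'd) \<Rightarrow> real ^ 'd \<Rightarrow> 'i \<Rightarrow> real" where
  "feature_dist Z Zt i = norm (Z i - Zt)"

definition kernel_weight ::
    "(real \<Rightarrow> real) \<Rightarrow> 'i set \<Rightarrow> ('i \<Rightarrow> real ^ 'd) \<Rightarrow> real ^ 'd \<Rightarrow> 'i \<Rightarrow> real" where
  "kernel_weight \<phi> I Z Zt i =
     \<phi> (feature_dist Z Zt i) / (\<Sum>j\<in>I. \<phi> (feature_dist Z Zt j))"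

definition weighted_dist ::
    "(real \<Rightarrow> real) \<Rightarrow> 'i set \<Rightarrow> ('i \<Rightarrow> real ^ 'd) \<Rightarrow> real ^ 'd \<Rightarrow> real" where
  "weighted_dist \<phi> I Z Zt = (\<Sum>i\<in>I. kernel_weight \<phi> I Z Zt i * feature_dist Z Zt i)"

end

theory Submission
  imports Defs
begin

text \<open>The claim is Chebyshev's sum inequality for the oppositely ordered families
  \<open>\<phi> (d i)\<close> and \<open>d i\<close>: every product
  \<open>(\<phi> (d i) - \<phi> (d j)) * (d i - d j)\<close> is nonpositive, and summing over all pairs
  \<open>(i, j)\<close> compares \<open>N * (\<Sum>i. \<phi> (d i) * d i)\<close> with
  \<open>(\<Sum>i. \<phi> (d i)) * (\<Sum>i. d i)\<close>.\<close>

lemma Chebyshev_sum_le_opposite: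
  fixes f g :: "'a \<Rightarrow> real"
  assumes "\<And>i j. i \<in> I \<Longrightarrow> j \<in> I \<Longrightarrow> (f i - f j) * (g i - g j) \<le> 0"
  shows "real (card I) * (\<Sum>i\<in>I. f i * g i) \<le> (\<Sum>i\<in>I. f i) * (\<Sum>i\<in>I. g i)"
proof -
  \<comment> \<open>Finiteness of \<open>I\<close> is not assumed: for infinite \<open>I\<close>,
    \<open>card\<close> and \<open>sum\<close> default to 0 and the identities persist.\<close>
  have "(\<Sum>i\<in>I. \<Sum>j\<in>I. (f i - f j) * (g i - g j))
      = (\<Sum>i\<in>I. \<Sum>j\<in>I. f i * g i) + (\<Sum>i\<in>I. \<Sum>j\<in>I. f j * g j)
        - (\<Sum>i\<in>I. \<Sum>j\<in>I. f i * g j) - (\<Sum>i\<in>I. \<Sum>j\<in>I. f j * g i)"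
    by (simp add: algebra_simps sum.distrib sum_subtractf)
  \<comment> \<open>Exchanging the order of summation merges the two cross terms; this gives one
    half of the factor 2 below. The other half comes from the two diagonal sums, each
    \<open>card I\<close> copies of the same sum.\<close>
  also have "(\<Sum>i\<in>I. \<Sum>j\<in>I. f j * g i) = (\<Sum>i\<in>I. \<Sum>j\<in>I. f i * g j)"
    by (rule sum.swap)
  also have "(\<Sum>i\<in>I. \<Sum>j\<in>I. f i * g j) = (\<Sum>i\<in>I. f i) * (\<Sum>i\<in>I. g i)"
    by (simp add: sum_product)
  also have "(\<Sum>i\<in>I. \<Sum>j\<in>I. f i * g i) = real (card I) * (\<Sum>i\<in>I. f i * g i)"
    by (simp add: sum_distrib_left)
  finally have "(\<Sum>i\<in>I. \<Sum>j\<in>I. (f i - f j) * (g i - g j))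
      = 2 * (real (card I) * (\<Sum>i\<in>I. f i * g i) - (\<Sum>i\<in>I. f i) * (\<Sum>i\<in>I. g i))"
    by simp
  moreover have "(\<Sum>i\<in>I. \<Sum>j\<in>I. (f i - f j) * (g i - g j)) \<le> 0"
    by (intro sum_nonpos assms)
  ultimately show ?thesis by simp
qed

theorem lemma1:
  fixes I :: "'i set" and Z :: "'i \<Rightarrow> real ^ 'd" and Zt :: "real ^ 'd"
    and \<phi> :: "real \<Rightarrow> real"
  assumes "finite I" and "I \<noteq> {}"
    and "\<phi> \<in> {0..} \<rightarrow> {0..}"
    and "antimono_on {0..} \<phi>"
    and "\<exists>i\<in>I. \<phi> (feature_dist Z Zt i) \<noteq> 0"
  shows "weighted_dist \<phi> I Z Zt \<le> (1 / real (card I)) * (\<Sum>i\<in>I. feature_dist Z Zt i)"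
proof -
  define d where "d = feature_dist Z Zt"
  define S where "S = (\<Sum>i\<in>I. \<phi> (d i))"
  have d_nonneg: "0 \<le> d i" for i
    by (simp add: d_def feature_dist_def)
  have \<phi>_nonneg: "0 \<le> \<phi> (d i)" for i
    using assms(3) d_nonneg by auto
  \<comment> \<open>One nonzero value among nonnegative ones makes the normalizing constant
    positive, so the weights are genuine quotients and division by \<open>S\<close> preserves the
    inequality.\<close>
  have S_pos: "0 < S"
  proof -
    obtain k where "k \<in> I" "\<phi> (d k) \<noteq> 0"
      using assms(5) by (auto simp: d_def)
    then show ?thesis
      unfolding S_def using assms(1) \<phi>_nonneg
      by (intro sum_pos2[of I k]) (auto simp: less_le)
  qed
  have card_pos: "0 < real (card I)"
    using assms(1,2) by (simp add: card_gt_0_iff)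
  \<comment> \<open>Distances lie in \<open>{0..}\<close>, where \<open>\<phi>\<close> is antitone,
    so the two factors never have the same strict sign.\<close>
  have "(\<phi> (d i) - \<phi> (d j)) * (d i - d j) \<le> 0" for i j
  proof (cases "d i \<le> d j")
    case True
    then have "\<phi> (d j) \<le> \<phi> (d i)"
      using assms(4) d_nonneg by (auto simp: monotone_on_def)
    with True show ?thesis by (simp add: mult_nonneg_nonpos)
  next
    case False
    then have "\<phi> (d i) \<le> \<phi> (d j)"
      using assms(4) d_nonneg by (auto simp: monotone_on_def)
    with False show ?thesis by (simp add: mult_nonpos_nonneg)
  qed
  then have "real (card I) * (\<Sum>i\<in>I. \<phi> (d i) * d i) \<le> S * (\<Sum>i\<in>I. d i)"
    unfolding S_def by (rule Chebyshev_sum_le_opposite)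
  \<comment> \<open>Division by the positive number \<open>S * card I\<close> turns the Chebyshev
    bound into a comparison of averages.\<close>
  then have "(\<Sum>i\<in>I. \<phi> (d i) * d i) / S \<le> (1 / real (card I)) * (\<Sum>i\<in>I. d i)"
    using S_pos card_pos by (simp add: field_simps)
  moreover have "weighted_dist \<phi> I Z Zt = (\<Sum>i\<in>I. \<phi> (d i) * d i) / S"
    by (simp add: weighted_dist_def kernel_weight_def S_def d_def sum_divide_distrib)
  ultimately show ?thesis by (simp add: d_def)
qed

end
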